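(* Let $X$ be an uncountable regular open Whyburn space. The following are equivalent: (1) $X$ satisfies $S_{fin}(\Omega^s,\Omega^s)$; (2) $X$ satisfies $S_{fin}(\mathcal{K}_{\Omega},\mathcal{K}_{\Omega})$; (3) $vet(\mathbf{0},Q_p(X,\mathbb{R}))=\omega$; (4) $vet(f,Q_p(X,\mathbb{R}))=\omega$ for every continuous $f:X\to\mathbb{R}$; (5) $vet(Q_p(X,\mathbb{D}))=\omega$.
   Context: All spaces are assumed regular. A function $f:X\to Y$ is quasicontinuous if for every $x\in X$, every open $V\ni f(x)$ and every open $U\ni x$ there is a nonempty open $W\subseteq U$ with $f(W)\subseteq V$. $Q_p(X,Y)$ is the set of all quasicontinuous functions $X\to Y$ with the topology of pointwise convergence; $\mathbb{D}=\{0,1\}$ is discrete; $\mathbf{0}$ is the constant zero function. $X$ is open Whyburn if for every open $A\subseteq X$ and every $x\in\overline{A}\setminus A$ there is an open $B\subseteq A$ with $\overline{B}\setminus A=\{x\}$. A set $A$ is minimally bounded if $A\subseteq\overline{\mathrm{Int}A}$ and $\mathrm{Int}\overline{A}\subseteq A$. $\Omega^s$ is the collection of covers of $X$ by minimally bounded sets which are $\omega$-covers (every finite subset of $X$ lies in some member). $\mathcal{K}_\Omega$ is the set of families $\mathcal{U}$ of open subsets of $X$ with $X=\bigcup\{\overline{U}:U\in\mathcal{U}\}$, no element of $\mathcal{U}$ dense in $X$, and for each finite $F\subseteq X$ some $U\in\mathcal{U}$ with $F\subseteq\overline{U}$. $S_{fin}(\mathcal{A},\mathcal{B})$: for every sequence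 $(A_n)_{n\in\mathbb{N}}$ of elements of $\mathcal{A}$ there are finite $B_n\subseteq A_n$ with $\bigcup_n B_n\in\mathcal{B}$. For a space $Z$ and $z\in Z$, $vet(z,Z)=\omega$ means: for every sequence $(A_n)_{n\in\omega}$ of subsets of $Z$ with $z\in\bigcap_n\overline{A_n}$ there are finite $K_n\subseteq A_n$ with $z\in\overline{\bigcup_n K_n}$; $vet(Z)=\omega$ means this holds for all $z\in Z$. *)

theory Defs
  imports "HOL-Analysis.Analysis"
begin

definition quasicontinuous :: "'a topology \<Rightarrow> 'b topology \<Rightarrow> ('a \<Rightarrow> 'b) \<Rightarrow> bool" where
  "quasicontinuous X Y f \<longleftrightarrow>
     f \<in> topspace X \<rightarrow> topspace Y \<and>
     (\<forall>x\<in>topspace X. \<forall>V U. openin Y V \<and> f x \<in> V \<and> openin X U \<and> x \<in> U \<longrightarrow>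
        (\<exists>W. openin X W \<and> W \<noteq> {} \<and> W \<subseteq> U \<and> f ` W \<subseteq> V))"

text \<open>Q_p(X,Y): quasicontinuous functions (represented extensionally on topspace X)
  with the topology of pointwise convergence, i.e. as a subspace of the product topology.\<close>
definition Qp :: "'a topology \<Rightarrow> 'b topology \<Rightarrow> ('a \<Rightarrow> 'b) topology" where
  "Qp X Y = subtopology (product_topology (\<lambda>_. Y) (topspace X))
              {f \<in> topspace X \<rightarrow>\<^sub>E topspace Y. quasicontinuous X Y f}"

definition open_Whyburn :: "'a topology \<Rightarrow> bool" where
  "open_Whyburn X \<longleftrightarrow>
     (\<forall>A. openin X A \<longrightarrow> (\<forall>x \<in> X closure_of A - A.
        \<exists>B. openin X B \<and> B \<subseteq> A \<and> X closure_of B - A = {x}))"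

definition minimally_bounded :: "'a topology \<Rightarrow> 'a set \<Rightarrow> bool" where
  "minimally_bounded X A \<longleftrightarrow>
     A \<subseteq> X closure_of (X interior_of A) \<and> X interior_of (X closure_of A) \<subseteq> A"

definition Omega_s :: "'a topology \<Rightarrow> 'a set set set" where
  "Omega_s X = {\<U>. (\<forall>U\<in>\<U>. U \<subseteq> topspace X \<and> minimally_bounded X U) \<and>
                   \<Union>\<U> = topspace X \<and>
                   (\<forall>F. finite F \<and> F \<subseteq> topspace X \<longrightarrow> (\<exists>U\<in>\<U>. F \<subseteq> U))}"

definition K_Omega :: "'a topology \<Rightarrow> 'a set set set" where
  "K_Omega X = {\<U>. (\<forall>U\<in>\<U>. openin X U) \<and>
                   topspace X = (\<Union>U\<in>\<U>. X closure_of U) \<and>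
                   (\<forall>U\<in>\<U>. X closure_of U \<noteq> topspace X) \<and>
                   (\<forall>F. finite F \<and> F \<subseteq> topspace X \<longrightarrow> (\<exists>U\<in>\<U>. F \<subseteq> X closure_of U))}"

definition S_fin :: "'a set set set \<Rightarrow> 'a set set set \<Rightarrow> bool" where
  "S_fin \<A> \<B> \<longleftrightarrow>
     (\<forall>A :: nat \<Rightarrow> 'a set set. (\<forall>n. A n \<in> \<A>) \<longrightarrow>
        (\<exists>B. (\<forall>n. finite (B n) \<and> B n \<subseteq> A n) \<and> (\<Union>n. B n) \<in> \<B>))"

definition vet_omega_at :: "'b topology \<Rightarrow> 'b \<Rightarrow> bool" where
  "vet_omega_at Z z \<longleftrightarrow>
     (\<forall>A :: nat \<Rightarrow> 'b set. (\<forall>n. A n \<subseteq> topspace Z \<and> z \<in> Z closure_of (A n)) \<longrightarrow>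
        (\<exists>K. (\<forall>n. finite (K n) \<and> K n \<subseteq> A n) \<and> z \<in> Z closure_of (\<Union>n. K n)))"

definition vet_omega :: "'b topology \<Rightarrow> bool" where
  "vet_omega Z \<longleftrightarrow> (\<forall>z\<in>topspace Z. vet_omega_at Z z)"

end

theory Submission
  imports Defs
begin

text \<open>Regular closed sets are minimally bounded, which gives (1) \<open>\<Longrightarrow>\<close> (2), and a set is minimally
  bounded iff its indicator function is quasicontinuous, which gives (3) \<open>\<Longrightarrow>\<close> (1) and (5) \<open>\<Longrightarrow>\<close> (1).

  The main step deduces fan tightness at \<open>z\<close> from (2). If \<open>z\<close> is continuous, the set where a
  quasicontinuous \<open>g\<close> is close to \<open>z\<close> is contained in the closure of its interior, and the open
  Whyburn property shrinks this interior to an open set with closure in the set, still reaching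
  any prescribed finite part of it. A quasicontinuous two-valued \<open>z\<close> is only continuous on an open
  dense \<open>G\<close>; here (2) forces nowhere dense sets to be countable, then disjoint families of open
  sets to be countable, and hence open sets to be \<open>F\<^sub>\<sigma>\<close>. So the countable set of discontinuities can
  be treated one point at a time along an exhaustion of \<open>G\<close> by closed sets.\<close>

section \<open>Regularity and the open Whyburn property for finite sets\<close>

text \<open>Regularity treats a single point, and the closure of a finite union is the union of the
  closures, so induction on \<open>F\<close> suffices.\<close>

lemma regular_space_finite_nhd:
  assumes "regular_space X" and "openin X W" and "finite F" and "F \<subseteq> W"
  obtains U where "openin X U" and "F \<subseteq> U" and "X closure_of U \<subseteq> W"
proof -
  have pt: "\<exists>U. openin X U \<and> x \<in> U \<and> X closure_of U \<subseteq> W" if "x \<in> W" for x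
  proof -
    have "neighbourhood_base_of (closedin X) X"
      using assms(1) neighbourhood_base_of_closedin by blast
    then obtain U C where "openin X U" "closedin X C" "x \<in> U" "U \<subseteq> C" "C \<subseteq> W"
      using \<open>x \<in> W\<close> assms(2) unfolding neighbourhood_base_of by meson
    then show ?thesis
      by (meson closure_of_minimal order_trans)
  qed
  have "\<exists>U. openin X U \<and> F \<subseteq> U \<and> X closure_of U \<subseteq> W"
    using assms(3,4)
  proof (induction F)
    case empty
    then show ?case
      by (intro exI[of _ "{}"]) auto
  next
    case (insert x F)
    then obtain U where U: "openin X U" "F \<subseteq> U" "X closure_of U \<subseteq> W"
      by auto
    obtain U' where U': "openin X U'" "x \<in> U'" "X closure_of U' \<subseteq> W"
      using pt insert.prems by blast
    show ?case
      using U U' by (intro exI[of _ "U \<union> U'"]) auto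
  qed
  then show thesis
    using that by blast
qed

text \<open>Limit points outside \<open>A\<close> are handled by the Whyburn property, points of
  \<open>A\<close> by regularity, and the finitely many pieces are united. The last conclusion later
  makes a condition known on \<open>A\<close> and on \<open>F\<close> hold on a whole
  closure.\<close>

lemma open_Whyburn_finite:
  assumes "regular_space X" and "open_Whyburn X" and "openin X A"
    and "finite F" and "F \<subseteq> X closure_of A"
  obtains B where "openin X B" and "B \<subseteq> A" and "F \<subseteq> X closure_of B" and "X closure_of B \<subseteq> A \<union> F"
proof -
  have pt: "\<exists>B. openin X B \<and> B \<subseteq> A \<and> x \<in> X closure_of B \<and> X closure_of B \<subseteq> A \<union> {x}"
    if x: "x \<in> X closure_of A" for x
  proof (cases "x \<in> A")
    case True
    then obtain U where U: "openin X U" "{x} \<subseteq> U" "X closure_of U \<subseteq> A"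
      using regular_space_finite_nhd[OF assms(1,3), of "{x}"] by blast
    moreover have "U \<subseteq> X closure_of U"
      using U(1) by (simp add: closure_of_subset openin_subset)
    ultimately show ?thesis
      by blast
  next
    case False
    then obtain B where "openin X B" "B \<subseteq> A" "X closure_of B - A = {x}"
      using x assms(2)[unfolded open_Whyburn_def, rule_format, OF assms(3), of x] by auto
    then show ?thesis
      by blast
  qed
  have "\<exists>B. openin X B \<and> B \<subseteq> A \<and> F \<subseteq> X closure_of B \<and> X closure_of B \<subseteq> A \<union> F"
    using assms(4,5)
  proof (induction F)
    case empty
    then show ?case
      by (intro exI[of _ "{}"]) auto
  next
    case (insert x F)
    then obtain B where B: "openin X B" "B \<subseteq> A" "F \<subseteq> X closure_of B" "X closure_of B \<subseteq> A \<union> F"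
      by auto
    obtain B' where B': "openin X B'" "B' \<subseteq> A" "x \<in> X closure_of B'" "X closure_of B' \<subseteq> A \<union> {x}"
      using pt insert.prems by blast
    show ?case
      using B B' by (intro exI[of _ "B \<union> B'"]) auto
  qed
  then show thesis
    using that by blast
qed

text \<open>An open \<open>U\<close> lies in the interior of its closure, which gives the first
  inclusion; the second is idempotence of the closure.\<close>

lemma minimally_bounded_closure_of_open:
  assumes "openin X U"
  shows "minimally_bounded X (X closure_of U)"
proof -
  have "U \<subseteq> X interior_of (X closure_of U)"
    using assms by (simp add: closure_of_subset interior_of_maximal openin_subset)
  then have "X closure_of U \<subseteq> X closure_of (X interior_of (X closure_of U))"
    by (rule closure_of_mono)
  then show ?thesis
    unfolding minimally_bounded_def by (simp add: interior_of_subset)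
qed

subsection \<open>Selections from families whose closures form an \<open>\<omega>\<close>-cover\<close>

text \<open>Unlike in \<^const>\<open>K_Omega\<close>, dense members are allowed.\<close>

definition closure_omega_cover :: "'a topology \<Rightarrow> 'a set set \<Rightarrow> bool" where
  "closure_omega_cover X \<U> \<longleftrightarrow>
     (\<forall>U\<in>\<U>. openin X U) \<and>
     (\<forall>F. finite F \<and> F \<subseteq> topspace X \<longrightarrow> (\<exists>U\<in>\<U>. F \<subseteq> X closure_of U))"

text \<open>The equation for \<open>topspace X\<close> is obtained from the finite-set condition at
  singletons.\<close>

lemma K_Omega_iff:
  "\<U> \<in> K_Omega X \<longleftrightarrow>
     closure_omega_cover X \<U> \<and> (\<forall>U\<in>\<U>. X closure_of U \<noteq> topspace X)"
proof -
  have "topspace X = (\<Union>U\<in>\<U>. X closure_of U)" if "closure_omega_cover X \<U>"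
  proof
    show "topspace X \<subseteq> (\<Union>U\<in>\<U>. X closure_of U)"
    proof
      fix x assume "x \<in> topspace X"
      then have "finite {x} \<and> {x} \<subseteq> topspace X"
        by simp
      then have "\<exists>U\<in>\<U>. {x} \<subseteq> X closure_of U"
        using that unfolding closure_omega_cover_def by blast
      then show "x \<in> (\<Union>U\<in>\<U>. X closure_of U)"
        by blast
    qed
    show "(\<Union>U\<in>\<U>. X closure_of U) \<subseteq> topspace X"
      by (simp add: UN_least closure_of_subset_topspace)
  qed
  then show ?thesis
    unfolding K_Omega_def closure_omega_cover_def mem_Collect_eq by argo
qed

lemma K_Omega_D:
  assumes "\<U> \<in> K_Omega X" and "finite F" and "F \<subseteq> topspace X"
  shows "\<exists>U\<in>\<U>. F \<subseteq> X closure_of U"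
  using assms by (simp add: K_Omega_def)

lemma Omega_s_D:
  assumes "\<U> \<in> Omega_s X" and "finite F" and "F \<subseteq> topspace X"
  shows "\<exists>U\<in>\<U>. F \<subseteq> U"
  using assms by (simp add: Omega_s_def)

text \<open>Arbitrarily late indices are what later allows tolerances to tend to zero. If dense
  members occur at infinitely many indices, one is picked each time; otherwise the selection
  principle is applied beyond an index after which none occurs.\<close>

lemma S_fin_K_Omega_frequently:
  fixes \<V> :: "nat \<Rightarrow> 'a set set"
  assumes S: "S_fin (K_Omega X) (K_Omega X)" and cov: "\<And>n. closure_omega_cover X (\<V> n)"
  obtains \<W> where "\<And>n. finite (\<W> n)" and "\<And>n. \<W> n \<subseteq> \<V> n"
    and "\<And>F m. finite F \<Longrightarrow> F \<subseteq> topspace X \<Longrightarrow> \<exists>n\<ge>m. \<exists>V\<in>\<W> n. F \<subseteq> X closure_of V"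
proof (cases "\<forall>m. \<exists>n\<ge>m. \<exists>V\<in>\<V> n. X closure_of V = topspace X")
  case True
  \<comment> \<open>Indices without a dense member receive the empty selection.\<close>
  define \<W> where "\<W> n = (if \<exists>V\<in>\<V> n. X closure_of V = topspace X
      then {SOME V. V \<in> \<V> n \<and> X closure_of V = topspace X} else {})" for n
  have ex: "\<W> n \<subseteq> \<V> n \<and> (\<exists>V\<in>\<W> n. X closure_of V = topspace X)"
    if "\<exists>V\<in>\<V> n. X closure_of V = topspace X" for n
  proof -
    have "\<exists>V. V \<in> \<V> n \<and> X closure_of V = topspace X"
      using that by blast
    then have "(SOME V. V \<in> \<V> n \<and> X closure_of V = topspace X) \<in> \<V> n \<and>
        X closure_of (SOME V. V \<in> \<V> n \<and> X closure_of V = topspace X) = topspace X"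
      by (rule someI_ex)
    then show ?thesis
      using that unfolding \<W>_def by simp
  qed
  show thesis
  proof (rule that[of \<W>])
    show "finite (\<W> n)" "\<W> n \<subseteq> \<V> n" for n
      using ex[of n] by (auto simp: \<W>_def)
    show "\<exists>n\<ge>m. \<exists>V\<in>\<W> n. F \<subseteq> X closure_of V" if "F \<subseteq> topspace X" for F m
      using True ex that by metis
  qed
next
  case False
  then obtain N where N: "\<And>n V. n \<ge> N \<Longrightarrow> V \<in> \<V> n \<Longrightarrow> X closure_of V \<noteq> topspace X"
    by blast
  then have "\<V> (n + N) \<in> K_Omega X" for n
    using cov unfolding K_Omega_iff by (meson le_add2)
  then obtain \<B> where \<B>: "\<And>n. finite (\<B> n)" "\<And>n. \<B> n \<subseteq> \<V> (n + N)" "(\<Union>n. \<B> n) \<in> K_Omega X"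
    using S[unfolded S_fin_def, rule_format, of "\<lambda>n. \<V> (n + N)"] by blast
  show thesis
  \<comment> \<open>The selection made for the shifted sequence is moved back to the original
    indices and is empty before \<open>N\<close>.\<close>
  proof (rule that[of "\<lambda>n. if n \<ge> N then \<B> (n - N) else {}"])
    show "finite (if n \<ge> N then \<B> (n - N) else {})"
      "(if n \<ge> N then \<B> (n - N) else {}) \<subseteq> \<V> n" for n
      using \<B>(1) \<B>(2)[of "n - N"] by auto
    fix F m assume F: "finite F" "F \<subseteq> topspace X"
    define \<E> where "\<E> = (\<Union>n<m. \<B> n)"
    have "\<forall>V\<in>\<E>. \<exists>x. x \<in> topspace X - X closure_of V"
    proof
      fix V assume "V \<in> \<E>"
      then have "X closure_of V \<noteq> topspace X"
        using \<B>(3) unfolding \<E>_def K_Omega_iff by auto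
      then show "\<exists>x. x \<in> topspace X - X closure_of V"
        using closure_of_subset_topspace[of X V] by blast
    qed
    then obtain p where p: "\<And>V. V \<in> \<E> \<Longrightarrow> p V \<in> topspace X - X closure_of V"
      by metis
    \<comment> \<open>Adding a point outside each of the finitely many early closures forces a late index.\<close>
    have "finite (F \<union> p ` \<E>)" "F \<union> p ` \<E> \<subseteq> topspace X"
      using F p \<B>(1) by (auto simp: \<E>_def)
    then obtain V where V: "V \<in> (\<Union>n. \<B> n)" "F \<union> p ` \<E> \<subseteq> X closure_of V"
      using K_Omega_D[OF \<B>(3)] by metis
    then have "V \<notin> \<E>"
      using p by blast
    then obtain n where "n \<ge> m" "V \<in> \<B> n"
      using V(1) unfolding \<E>_def by (metis UN_iff lessThan_iff not_less)
    then show "\<exists>n\<ge>m. \<exists>V\<in>if n \<ge> N then \<B> (n - N) else {}. F \<subseteq> X closure_of V"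
      using V(2) by (intro exI[of _ "n + N"]) auto
  qed
qed

text \<open>The selection is applied to a constant sequence; its countably many finite parts are
  united and tested on singletons.\<close>

lemma S_fin_K_Omega_countable_subcover:
  assumes "S_fin (K_Omega X) (K_Omega X)" and "closure_omega_cover X \<V>"
  obtains \<W> where "countable \<W>" and "\<W> \<subseteq> \<V>" and "topspace X \<subseteq> (\<Union>V\<in>\<W>. X closure_of V)"
proof -
  obtain \<W> :: "nat \<Rightarrow> 'a set set" where \<W>: "\<And>n. finite (\<W> n)" "\<And>n. \<W> n \<subseteq> \<V>"
    "\<And>F m. finite F \<Longrightarrow> F \<subseteq> topspace X \<Longrightarrow> \<exists>n\<ge>m. \<exists>V\<in>\<W> n. F \<subseteq> X closure_of V"
    using S_fin_K_Omega_frequently[OF assms(1), of "\<lambda>_. \<V>"] assms(2) by metis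
  show thesis
  proof (rule that[of "\<Union>n. \<W> n"])
    show "countable (\<Union>n. \<W> n)"
      using \<W>(1) by (simp add: countable_finite)
    show "topspace X \<subseteq> (\<Union>V\<in>\<Union>n. \<W> n. X closure_of V)"
    proof
      fix x assume "x \<in> topspace X"
      then have "\<exists>n\<ge>0. \<exists>V\<in>\<W> n. {x} \<subseteq> X closure_of V"
        by (intro \<W>(3)) auto
      then show "x \<in> (\<Union>V\<in>\<Union>n. \<W> n. X closure_of V)"
        by blast
    qed
  qed (use \<W>(2) in blast)
qed

subsection \<open>Smallness properties of the space\<close>

text \<open>The complement of \<open>N\<close> is open and dense, so the Whyburn property yields for
  every finite \<open>F\<close> an open set that reaches \<open>F\<close> and whose closure meets
  \<open>N\<close> only within \<open>F\<close>. Countably many closures with finite trace on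
  \<open>N\<close> then cover the space.\<close>

lemma S_fin_K_Omega_nowhere_dense_countable:
  assumes S: "S_fin (K_Omega X) (K_Omega X)" and X: "regular_space X" "open_Whyburn X"
    and N: "closedin X N" "X interior_of N = {}"
  shows "countable N"
proof -
  define G where "G = topspace X - N"
  have G: "openin X G" "X closure_of G = topspace X"
    using N by (auto simp: G_def closure_of_complement)
  have "closure_omega_cover X {B. openin X B \<and> finite (X closure_of B \<inter> N)}"
    unfolding closure_omega_cover_def
  proof (intro conjI allI impI)
    fix F assume F: "finite F \<and> F \<subseteq> topspace X"
    obtain B where B: "openin X B" "F \<subseteq> X closure_of B" "X closure_of B \<subseteq> G \<union> F"
      using open_Whyburn_finite[OF X G(1), of F] F G(2) by metis
    have "X closure_of B \<inter> N \<subseteq> F"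
      using B(3) by (auto simp: G_def)
    then show "\<exists>U\<in>{B. openin X B \<and> finite (X closure_of B \<inter> N)}. F \<subseteq> X closure_of U"
      using B F finite_subset by blast
  qed auto
  then obtain \<W> where \<W>: "countable \<W>" "\<W> \<subseteq> {B. openin X B \<and> finite (X closure_of B \<inter> N)}"
    "topspace X \<subseteq> (\<Union>V\<in>\<W>. X closure_of V)"
    by (rule S_fin_K_Omega_countable_subcover[OF S])
  have "countable (\<Union>V\<in>\<W>. X closure_of V \<inter> N)"
    using \<W>(1,2) by (intro countable_UN) (auto intro: countable_finite)
  moreover have "N \<subseteq> (\<Union>V\<in>\<W>. X closure_of V \<inter> N)"
    using \<W>(3) closedin_subset[OF N(1)] by blast
  ultimately show ?thesis
    using countable_subset by blast
qed

text \<open>An infinite set is in bijection with its square; the parts are the images of the fibres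
  \<open>{a} \<times> I\<close>.\<close>

lemma uncountable_partition:
  assumes "uncountable I"
  obtains P where "\<And>a. a \<in> I \<Longrightarrow> P a \<subseteq> I" and "\<And>a. a \<in> I \<Longrightarrow> uncountable (P a)"
    and "\<And>a b. a \<in> I \<Longrightarrow> b \<in> I \<Longrightarrow> a \<noteq> b \<Longrightarrow> P a \<inter> P b = {}"
proof -
  have "infinite I"
    using assms countable_finite by blast
  then obtain h where h: "bij_betw h (I \<times> I) I"
    using card_of_Times_same_infinite card_of_ordIso by blast
  show thesis
  proof (rule that[of "\<lambda>a. h ` ({a} \<times> I)"])
    fix a assume a: "a \<in> I"
    show "h ` ({a} \<times> I) \<subseteq> I"
      using h a by (auto simp: bij_betw_def)
    have "inj_on (\<lambda>i. h (a, i)) I"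
      using h a by (auto simp: bij_betw_def inj_on_def)
    moreover have "h ` ({a} \<times> I) = (\<lambda>i. h (a, i)) ` I"
      by auto
    ultimately show "uncountable (h ` ({a} \<times> I))"
      using assms by (simp add: countable_image_inj_eq)
    fix b assume "b \<in> I" "a \<noteq> b"
    then show "h ` ({a} \<times> I) \<inter> h ` ({b} \<times> I) = {}"
      using h a by (auto simp: bij_betw_def inj_on_def)
  qed
qed

lemma openin_Int_closure_of_disjoint:
  assumes "openin X U" and "U \<inter> T = {}"
  shows "U \<inter> X closure_of T = {}"
  using assms by (simp add: openin_Int_closure_of_eq_empty)

text \<open>An uncountable family splits into uncountably many disjoint uncountable subfamilies. A point
  has a neighbourhood inside the closure of the union of at most one of them, so some subfamily is
  removable: the remaining open set still has all of the countable set \<open>N\<close> in its closure.\<close>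

lemma S_fin_K_Omega_disjoint_open_countable:
  assumes S: "S_fin (K_Omega X) (K_Omega X)" and X: "regular_space X" "open_Whyburn X"
    and \<D>: "\<And>D. D \<in> \<D> \<Longrightarrow> openin X D" "\<And>D. D \<in> \<D> \<Longrightarrow> D \<noteq> {}" "pairwise disjnt \<D>"
  shows "countable \<D>"
proof (rule ccontr)
  assume unc: "uncountable \<D>"
  obtain P where P: "\<And>a. a \<in> \<D> \<Longrightarrow> P a \<subseteq> \<D>" "\<And>a. a \<in> \<D> \<Longrightarrow> uncountable (P a)"
    "\<And>a b. a \<in> \<D> \<Longrightarrow> b \<in> \<D> \<Longrightarrow> a \<noteq> b \<Longrightarrow> P a \<inter> P b = {}"
    using uncountable_partition[OF unc] by metis
  \<comment> \<open>\<open>M\<close> is the open exterior of the family. Together with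
    \<open>\<Union>\<D>\<close> it is dense, so the remainder \<open>N\<close> is closed and nowhere
    dense.\<close>
  define M where "M = topspace X - X closure_of (\<Union>\<D>)"
  \<comment> \<open>\<open>R a\<close> is the region to be removed and \<open>Q a\<close> the open
    set that remains.\<close>
  define R where "R a = \<Union>(P a)" for a
  define Q where "Q a = \<Union>(\<D> - P a) \<union> M" for a
  define N where "N = topspace X - (\<Union>\<D> \<union> M)"
  have op\<D>: "openin X (\<Union>\<D>)"
    using \<D>(1) by blast
  have opM: "openin X M"
    unfolding M_def by (intro openin_diff) auto
  have opQ: "openin X (Q a)" for a
    unfolding Q_def using \<D>(1) opM by blast
  have opR: "openin X (R a)" if "a \<in> \<D>" for a
    unfolding R_def using \<D>(1) P(1)[OF that] by blast
  have "closedin X N"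
    unfolding N_def using op\<D> opM by blast
  moreover have "X interior_of N = {}"
  proof -
    have sub: "X interior_of N \<subseteq> N"
      by (rule interior_of_subset)
    have "N \<subseteq> X closure_of (\<Union>\<D>)"
      unfolding N_def M_def by blast
    moreover have "X interior_of N \<inter> \<Union>\<D> = {}"
      using sub unfolding N_def by blast
    then have "X interior_of N \<inter> X closure_of (\<Union>\<D>) = {}"
      by (intro openin_Int_closure_of_disjoint) auto
    ultimately show ?thesis
      using sub by blast
  qed
  ultimately have N: "countable N"
    using S_fin_K_Omega_nowhere_dense_countable[OF S X] by blast
  have disjRQ: "R a \<inter> Q a = {}" if "a \<in> \<D>" for a
  proof -
    have "D \<inter> E = {}" if "D \<in> P a" "E \<in> \<D> - P a" for D E
      using pairwiseD[OF \<D>(3), of D E] P(1)[OF \<open>a \<in> \<D>\<close>] that by (auto simp: disjnt_def)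
    moreover have "\<Union>\<D> \<subseteq> X closure_of (\<Union>\<D>)"
      using op\<D> by (simp add: closure_of_subset openin_subset)
    ultimately show ?thesis
      using P(1)[OF that] unfolding R_def Q_def M_def by blast
  qed
  \<comment> \<open>Otherwise every \<open>a\<close> has a witness in \<open>N\<close>, and
    witnesses for distinct \<open>a\<close> and \<open>b\<close> differ because \<open>Q a\<close>
    and \<open>Q b\<close> have a dense union. This would embed \<open>\<D>\<close> into a countable
    set.\<close>
  have "\<exists>a\<in>\<D>. N \<subseteq> X closure_of (Q a)"
  proof (rule ccontr)
    assume "\<not> ?thesis"
    then have "\<forall>a\<in>\<D>. \<exists>x. x \<in> N - X closure_of (Q a)"
      by blast
    then obtain q where q: "\<And>a. a \<in> \<D> \<Longrightarrow> q a \<in> N - X closure_of (Q a)"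
      by metis
    have "inj_on q \<D>"
    proof (rule inj_onI, rule ccontr)
      fix a b assume ab: "a \<in> \<D>" "b \<in> \<D>" "q a = q b" "a \<noteq> b"
      have "P a \<inter> P b = {}"
        using P(3) ab by blast
      then have "\<Union>\<D> \<union> M \<subseteq> Q a \<union> Q b"
        unfolding Q_def by blast
      then have "X closure_of (\<Union>\<D> \<union> M) \<subseteq> X closure_of (Q a) \<union> X closure_of (Q b)"
        by (metis closure_of_Un closure_of_mono)
      moreover have "M \<subseteq> X closure_of M"
        using opM by (simp add: closure_of_subset openin_subset)
      then have "topspace X \<subseteq> X closure_of (\<Union>\<D> \<union> M)"
        unfolding closure_of_Un using M_def by blast
      moreover have "q a \<in> topspace X"
        using q[OF ab(1)] unfolding N_def by blast
      ultimately show False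
        using q[OF ab(1)] q[OF ab(2)] ab(3) by auto
    qed
    moreover have "q ` \<D> \<subseteq> N"
      using q by blast
    ultimately have "countable \<D>"
      using N countable_image_inj_on countable_subset by blast
    then show False
      using unc by blast
  qed
  then obtain a where a: "a \<in> \<D>" "N \<subseteq> X closure_of (Q a)"
    by blast
  \<comment> \<open>The closure of a member takes in everything outside \<open>R a\<close>, but
    inside \<open>R a\<close> it stays within finitely many sets of \<open>P a\<close>.\<close>
  define \<V> where "\<V> = {B \<union> Q a | B \<F>. openin X B \<and> finite \<F> \<and> \<F> \<subseteq> P a \<and> X closure_of B \<subseteq> \<Union>\<F>}"
  have "closure_omega_cover X \<V>"
    unfolding closure_omega_cover_def
  proof (intro conjI allI impI ballI)
    show "openin X U" if "U \<in> \<V>" for U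
      using that opQ unfolding \<V>_def by blast
    fix F assume F: "finite F \<and> F \<subseteq> topspace X"
    have "F \<inter> R a \<subseteq> \<Union>(P a)" "finite (F \<inter> R a)"
      using F by (auto simp: R_def)
    then obtain \<F> where \<F>: "finite \<F>" "\<F> \<subseteq> P a" "F \<inter> R a \<subseteq> \<Union>\<F>"
      using finite_subset_Union[of "F \<inter> R a" "P a"] by blast
    have "openin X (\<Union>\<F>)"
      using \<F>(2) P(1)[OF a(1)] \<D>(1) by blast
    then obtain B where B: "openin X B" "F \<inter> R a \<subseteq> B" "X closure_of B \<subseteq> \<Union>\<F>"
      using regular_space_finite_nhd[OF X(1)] \<open>finite (F \<inter> R a)\<close> \<F>(3) by metis
    have "B \<subseteq> X closure_of B" "Q a \<subseteq> X closure_of Q a"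
      using B(1) opQ by (simp_all add: closure_of_subset openin_subset)
    moreover have "topspace X \<subseteq> R a \<union> Q a \<union> N"
      unfolding R_def Q_def N_def by blast
    ultimately have "F \<subseteq> X closure_of (B \<union> Q a)"
      using F B(2) a(2) unfolding closure_of_Un by blast
    moreover have "B \<union> Q a \<in> \<V>"
      using B \<F> unfolding \<V>_def by blast
    ultimately show "\<exists>U\<in>\<V>. F \<subseteq> X closure_of U"
      by blast
  qed
  then obtain \<W> where \<W>: "countable \<W>" "\<W> \<subseteq> \<V>" "topspace X \<subseteq> (\<Union>V\<in>\<W>. X closure_of V)"
    by (rule S_fin_K_Omega_countable_subcover[OF S])
  have "\<forall>V\<in>\<W>. \<exists>\<F>. finite \<F> \<and> \<F> \<subseteq> P a \<and> X closure_of V \<inter> R a \<subseteq> \<Union>\<F>"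
  proof
    fix V assume "V \<in> \<W>"
    then have "V \<in> \<V>"
      using \<W>(2) by blast
    then obtain B \<F> where B: "V = B \<union> Q a" "finite \<F>" "\<F> \<subseteq> P a" "X closure_of B \<subseteq> \<Union>\<F>"
      unfolding \<V>_def mem_Collect_eq by metis
    have "R a \<inter> X closure_of Q a = {}"
      using openin_Int_closure_of_disjoint[OF opR disjRQ] a(1) by blast
    then have "X closure_of V \<inter> R a \<subseteq> \<Union>\<F>"
      using B(1,4) by auto
    then show "\<exists>\<F>. finite \<F> \<and> \<F> \<subseteq> P a \<and> X closure_of V \<inter> R a \<subseteq> \<Union>\<F>"
      using B by blast
  qed
  then obtain \<F> where \<F>: "\<And>V. V \<in> \<W> \<Longrightarrow> finite (\<F> V)" "\<And>V. V \<in> \<W> \<Longrightarrow> \<F> V \<subseteq> P a"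
    "\<And>V. V \<in> \<W> \<Longrightarrow> X closure_of V \<inter> R a \<subseteq> \<Union>(\<F> V)"
    by metis
  \<comment> \<open>Every \<open>D\<close> in \<open>P a\<close> has a point in the closure of some
    selected member, and by disjointness \<open>D\<close> is one of the finitely many sets attached
    to that member.\<close>
  have "P a \<subseteq> (\<Union>V\<in>\<W>. \<F> V)"
  proof
    fix D assume D: "D \<in> P a"
    then have "D \<in> \<D>"
      using P(1) a(1) by blast
    then obtain y where y: "y \<in> D" "y \<in> topspace X"
      using \<D>(1,2) openin_subset by blast
    then obtain V where V: "V \<in> \<W>" "y \<in> X closure_of V"
      using \<W>(3) by blast
    then obtain E where E: "E \<in> \<F> V" "y \<in> E"
      using \<F>(3)[OF V(1)] y D unfolding R_def by blast
    then have "E \<in> \<D>"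
      using \<F>(2)[OF V(1)] P(1)[OF a(1)] by blast
    then have "E = D"
      using \<D>(3) \<open>D \<in> \<D>\<close> E(2) y(1) unfolding pairwise_def disjnt_def by blast
    then show "D \<in> (\<Union>V\<in>\<W>. \<F> V)"
      using E V by blast
  qed
  moreover have "countable (\<Union>V\<in>\<W>. \<F> V)"
    using \<W>(1) \<F>(1) by (intro countable_UN) (auto intro: countable_finite)
  ultimately show False
    using P(2)[OF a(1)] countable_subset by blast
qed

text \<open>Zorn's lemma gives a maximal disjoint family of nonempty open sets with closures in
  \<open>G\<close>. It is countable and its union is dense in \<open>G\<close>; the rest of
  \<open>G\<close> lies in a closed nowhere dense set and is countable too. So countably many
  closures and singletons exhaust \<open>G\<close>.\<close>

lemma S_fin_K_Omega_open_fsigma: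
  assumes S: "S_fin (K_Omega X) (K_Omega X)" and X: "regular_space X" "t1_space X" "open_Whyburn X"
    and G: "openin X G"
  shows "fsigma_in X G"
proof -
  define \<A> where "\<A> = {\<D>. (\<forall>D\<in>\<D>. openin X D \<and> D \<noteq> {} \<and> X closure_of D \<subseteq> G) \<and> pairwise disjnt \<D>}"
  have "\<exists>M\<in>\<A>. \<forall>Z\<in>\<A>. M \<subseteq> Z \<longrightarrow> Z = M"
  proof (rule subset_Zorn')
    fix C assume C: "subset.chain \<A> C"
    have "pairwise disjnt (\<Union>C)"
      unfolding pairwise_def
    proof (intro ballI impI)
      fix D E assume "D \<in> \<Union>C" "E \<in> \<Union>C" "D \<noteq> E"
      then obtain \<D> \<E> where "\<D> \<in> C" "D \<in> \<D>" "\<E> \<in> C" "E \<in> \<E>"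
        by blast
      moreover from this have "\<D> \<subseteq> \<E> \<or> \<E> \<subseteq> \<D>"
        using C by (auto simp: subset_chain_def)
      ultimately obtain \<F> where \<F>: "\<F> \<in> C" "D \<in> \<F>" "E \<in> \<F>"
        by blast
      then have "pairwise disjnt \<F>"
        using C by (auto simp: subset_chain_def \<A>_def)
      then show "disjnt D E"
        using \<F> \<open>D \<noteq> E\<close> by (auto dest: pairwiseD)
    qed
    then show "\<Union>C \<in> \<A>"
      using C by (auto simp: subset_chain_def \<A>_def)
  qed
  then obtain \<D> where \<D>: "\<D> \<in> \<A>" and max: "\<And>Z. Z \<in> \<A> \<Longrightarrow> \<D> \<subseteq> Z \<Longrightarrow> Z = \<D>"
    by blast
  have D1: "openin X D" "D \<noteq> {}" "X closure_of D \<subseteq> G" if "D \<in> \<D>" for D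
    using \<D> that unfolding \<A>_def by auto
  have D2: "pairwise disjnt \<D>"
    using \<D> unfolding \<A>_def by auto
  have "countable \<D>"
    using S_fin_K_Omega_disjoint_open_countable[OF S X(1,3)] D1 D2 by blast
  define U where "U = \<Union>\<D>"
  have opU: "openin X U"
    unfolding U_def using D1(1) by blast
  have UC: "U \<subseteq> X closure_of U"
    using opU by (simp add: closure_of_subset openin_subset)
  \<comment> \<open>By regularity, a point of \<open>G\<close> off this closure would yield a
    further set \<open>E\<close> for the family, against maximality.\<close>
  have sub: "G \<subseteq> X closure_of U"
  proof
    fix x assume "x \<in> G"
    show "x \<in> X closure_of U"
    proof (rule ccontr)
      assume "x \<notin> X closure_of U"
      moreover have "openin X (G - X closure_of U)"
        using G by (simp add: openin_diff)
      ultimately obtain E where E: "openin X E" "{x} \<subseteq> E" "X closure_of E \<subseteq> G - X closure_of U"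
        using regular_space_finite_nhd[OF X(1), of "G - X closure_of U" "{x}"] \<open>x \<in> G\<close>
        by (metis Diff_iff finite.emptyI finite.insertI empty_subsetI insert_subset)
      have "E \<subseteq> X closure_of E"
        using E(1) by (simp add: closure_of_subset openin_subset)
      then have dj: "E \<inter> U = {}"
        using E(3) UC by blast
      then have "pairwise disjnt (insert E \<D>)"
        using D2 unfolding pairwise_insert U_def disjnt_def by blast
      then have "insert E \<D> \<in> \<A>"
        using D1 E unfolding \<A>_def by blast
      then have "E \<in> \<D>"
        using max by blast
      then show False
        using dj E(2) unfolding U_def by blast
    qed
  qed
  have "closedin X (X closure_of U - U)"
    using opU by (simp add: closedin_diff)
  moreover have "X interior_of (X closure_of U - U) = {}"
  proof -
    have "X interior_of (X closure_of U - U) \<subseteq> X closure_of U - U"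
      by (rule interior_of_subset)
    moreover from this have "X interior_of (X closure_of U - U) \<inter> X closure_of U = {}"
      by (intro openin_Int_closure_of_disjoint) auto
    ultimately show ?thesis
      by blast
  qed
  ultimately have "countable (X closure_of U - U)"
    using S_fin_K_Omega_nowhere_dense_countable[OF S X(1,3)] by blast
  then have cnt: "countable (G - U)"
    by (rule countable_subset[rotated]) (use sub in blast)
  have "G = \<Union>((\<lambda>D. X closure_of D) ` \<D> \<union> (\<lambda>x. {x}) ` (G - U))"
  proof
    show "G \<subseteq> \<Union>((\<lambda>D. X closure_of D) ` \<D> \<union> (\<lambda>x. {x}) ` (G - U))"
    proof
      fix x assume "x \<in> G"
      moreover have "D \<subseteq> X closure_of D" if "D \<in> \<D>" for D
        using D1(1)[OF that] by (simp add: closure_of_subset openin_subset)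
      ultimately show "x \<in> \<Union>((\<lambda>D. X closure_of D) ` \<D> \<union> (\<lambda>x. {x}) ` (G - U))"
        by (cases "x \<in> U") (auto simp: U_def)
    qed
  qed (use D1(3) in blast)
  moreover have "fsigma_in X (\<Union>((\<lambda>D. X closure_of D) ` \<D> \<union> (\<lambda>x. {x}) ` (G - U)))"
  proof (rule fsigma_in_Union)
    show "countable ((\<lambda>D. X closure_of D) ` \<D> \<union> (\<lambda>x. {x}) ` (G - U))"
      using \<open>countable \<D>\<close> cnt by blast
    fix T assume "T \<in> (\<lambda>D. X closure_of D) ` \<D> \<union> (\<lambda>x. {x}) ` (G - U)"
    moreover have "closedin X {x}" if "x \<in> G" for x
      using X(2) openin_subset[OF G] that by (auto simp: t1_space_closedin_singleton)
    ultimately have "closedin X T"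
      by auto
    then show "fsigma_in X T"
      by (rule closed_imp_fsigma_in)
  qed
  ultimately show ?thesis
    by simp
qed

subsection \<open>Fan tightness\<close>

lemma topspace_Qp:
  "topspace (Qp X Y) = {f \<in> topspace X \<rightarrow>\<^sub>E topspace Y. quasicontinuous X Y f}"
  unfolding Qp_def by (auto simp: PiE_def)

text \<open>These sets are traces of product boxes with the full factor outside
  \<open>F\<close>.\<close>

lemma Qp_basic_open:
  assumes "finite F" and "F \<subseteq> topspace X" and "\<And>x. x \<in> F \<Longrightarrow> openin Y (V x)"
  shows "openin (Qp X Y) {f \<in> topspace (Qp X Y). \<forall>x\<in>F. f x \<in> V x}"
proof -
  have "openin (product_topology (\<lambda>_. Y) (topspace X))
      (\<Pi>\<^sub>E x\<in>topspace X. if x \<in> F then V x else topspace Y)"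
  proof (rule product_topology_basis)
    show "openin Y (if x \<in> F then V x else topspace Y)" for x
      using assms(3) by simp
    show "finite {x. (if x \<in> F then V x else topspace Y) \<noteq> topspace Y}"
      by (rule finite_subset[OF _ assms(1)]) auto
  qed
  moreover have "{f \<in> topspace (Qp X Y). \<forall>x\<in>F. f x \<in> V x} =
      (\<Pi>\<^sub>E x\<in>topspace X. if x \<in> F then V x else topspace Y) \<inter>
      {f \<in> topspace X \<rightarrow>\<^sub>E topspace Y. quasicontinuous X Y f}"
  proof -
    have "V x \<subseteq> topspace Y" if "x \<in> F" for x
      using assms(3)[OF that] openin_subset by blast
    then show ?thesis
      unfolding topspace_Qp using assms(2) by (auto simp: PiE_iff extensional_def split: if_splits)
  qed
  ultimately show ?thesis
    unfolding Qp_def openin_subtopology by blast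
qed

text \<open>For metric values the finitely many radii of a basic neighbourhood can be replaced by
  their minimum. The target is an arbitrary subspace \<open>T\<close> so that one criterion serves
  both the reals and \<open>{0, 1}\<close>.\<close>

lemma in_closure_of_Qp:
  fixes T :: "'b::metric_space set"
  assumes A: "A \<subseteq> topspace (Qp X (top_of_set T))" and z: "z \<in> topspace (Qp X (top_of_set T))"
  shows "z \<in> Qp X (top_of_set T) closure_of A \<longleftrightarrow>
    (\<forall>F e. finite F \<and> F \<subseteq> topspace X \<and> e > 0 \<longrightarrow> (\<exists>g\<in>A. \<forall>x\<in>F. dist (g x) (z x) < e))"
    (is "?L \<longleftrightarrow> ?R")
proof
  assume L: ?L
  show ?R
  proof (intro allI impI)
    fix F and e :: real assume F: "finite F \<and> F \<subseteq> topspace X \<and> e > 0"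
    have "openin (top_of_set T) (T \<inter> ball (z x) e)" for x
      by (simp add: openin_open_Int)
    then have "openin (Qp X (top_of_set T))
        {f \<in> topspace (Qp X (top_of_set T)). \<forall>x\<in>F. f x \<in> T \<inter> ball (z x) e}"
      using F by (intro Qp_basic_open) auto
    moreover have "z \<in> {f \<in> topspace (Qp X (top_of_set T)). \<forall>x\<in>F. f x \<in> T \<inter> ball (z x) e}"
      using z F by (auto simp: topspace_Qp PiE_iff)
    ultimately have "\<exists>g. g \<in> A \<and> g \<in> {f \<in> topspace (Qp X (top_of_set T)). \<forall>x\<in>F. f x \<in> T \<inter> ball (z x) e}"
      using L[unfolded in_closure_of, THEN conjunct2, rule_format, OF conjI] by presburger
    then show "\<exists>g\<in>A. \<forall>x\<in>F. dist (g x) (z x) < e"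
      by (auto simp: dist_commute)
  qed
next
  assume R: ?R
  show ?L
    unfolding in_closure_of
  proof (intro conjI allI impI)
    show "z \<in> topspace (Qp X (top_of_set T))"
      by (rule z)
    fix O' assume O': "z \<in> O' \<and> openin (Qp X (top_of_set T)) O'"
    then obtain S where S: "openin (product_topology (\<lambda>_. top_of_set T) (topspace X)) S"
      "O' = S \<inter> {f \<in> topspace X \<rightarrow>\<^sub>E topspace (top_of_set T). quasicontinuous X (top_of_set T) f}"
      unfolding Qp_def openin_subtopology by blast
    have "z \<in> S"
      using O' S(2) by blast
    then have "\<exists>V. finite {i \<in> topspace X. V i \<noteq> topspace (top_of_set T)} \<and>
        (\<forall>i\<in>topspace X. openin (top_of_set T) (V i)) \<and> z \<in> Pi\<^sub>E (topspace X) V \<and> Pi\<^sub>E (topspace X) V \<subseteq> S"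
      by (rule S(1)[unfolded openin_product_topology_alt, rule_format])
    then obtain V where V: "finite {i \<in> topspace X. V i \<noteq> topspace (top_of_set T)}"
      "\<And>i. i \<in> topspace X \<Longrightarrow> openin (top_of_set T) (V i)" "z \<in> Pi\<^sub>E (topspace X) V"
      "Pi\<^sub>E (topspace X) V \<subseteq> S"
      by metis
    define F where "F = {i \<in> topspace X. V i \<noteq> topspace (top_of_set T)}"
    have "\<exists>e>0. \<forall>y\<in>T. dist y (z i) < e \<longrightarrow> y \<in> V i" if "i \<in> F" for i
    proof -
      have "openin (top_of_set T) (V i)" "z i \<in> V i"
        using that V(2,3) by (auto simp: F_def)
      then show ?thesis
        unfolding openin_euclidean_subtopology_iff by blast
    qed
    then obtain r where r: "\<And>i. i \<in> F \<Longrightarrow> r i > 0"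
      "\<And>i y. i \<in> F \<Longrightarrow> y \<in> T \<Longrightarrow> dist y (z i) < r i \<Longrightarrow> y \<in> V i"
      by metis
    \<comment> \<open>The inserted \<open>1\<close> keeps the minimum meaningful and positive when
      \<open>F\<close> is empty.\<close>
    define e where "e = Min (insert 1 (r ` F))"
    have fF: "finite F"
      using V(1) by (simp add: F_def)
    have e: "e > 0" "\<And>i. i \<in> F \<Longrightarrow> e \<le> r i"
      using fF r(1) by (auto simp: e_def)
    obtain g where g: "g \<in> A" "\<forall>x\<in>F. dist (g x) (z x) < e"
      using R[rule_format, of F e] fF e(1) by (auto simp: F_def)
    have gT: "g \<in> {f \<in> topspace X \<rightarrow>\<^sub>E topspace (top_of_set T). quasicontinuous X (top_of_set T) f}"
      using g(1) A unfolding topspace_Qp by blast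
    have "g i \<in> V i" if "i \<in> topspace X" for i
    proof (cases "i \<in> F")
      case True
      moreover have "g i \<in> T"
        using gT that by (auto simp: PiE_iff)
      ultimately show ?thesis
        using r(2) g(2) e(2) by (meson less_le_trans)
    next
      case False
      then show ?thesis
        using that gT by (auto simp: F_def PiE_iff)
    qed
    then have "g \<in> Pi\<^sub>E (topspace X) V"
      using gT by (auto simp: PiE_iff)
    then show "\<exists>y. y \<in> A \<and> y \<in> O'"
      using g(1) gT S(2) V(4) by blast
  qed
qed

text \<open>The trace of a finite set on the countable set \<open>N\<close> of possible discontinuities is put into
  the closures by the auxiliary sets \<open>Q m\<close>. Every point of \<open>G\<close> lies in only finitely many of
  their closures, so a late selection covers finite subsets of \<open>G\<close> by agreement sets alone.\<close>

lemma S_fin_K_Omega_imp_vet_omega_at: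
  fixes T :: "'b::metric_space set"
  assumes S: "S_fin (K_Omega X) (K_Omega X)" and X: "regular_space X" "t1_space X" "open_Whyburn X"
    and z: "z \<in> topspace (Qp X (top_of_set T))"
    and G: "openin X G" "X closure_of G = topspace X"
    and cont: "\<And>x e. x \<in> G \<Longrightarrow> e > 0 \<Longrightarrow> \<exists>U. openin X U \<and> x \<in> U \<and> (\<forall>y\<in>U. dist (z y) (z x) < e)"
  shows "vet_omega_at (Qp X (top_of_set T)) z"
  unfolding vet_omega_at_def
proof (intro allI impI)
  fix A :: "nat \<Rightarrow> ('a \<Rightarrow> 'b) set"
  assume A: "\<forall>n. A n \<subseteq> topspace (Qp X (top_of_set T)) \<and> z \<in> Qp X (top_of_set T) closure_of A n"
  have approx: "\<exists>g\<in>A n. \<forall>x\<in>F. dist (g x) (z x) < e"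
    if "finite F" "F \<subseteq> topspace X" "e > 0" for n F e
    using in_closure_of_Qp[of "A n" X T z] A z that by blast
  define N where "N = topspace X - G"
  have "closedin X N" "X interior_of N = {}"
    unfolding N_def using G by (auto simp: interior_of_complement)
  then have N: "countable N"
    using S_fin_K_Omega_nowhere_dense_countable[OF S X(1,3)] by blast
  \<comment> \<open>Finite initial segments of an enumeration exhaust \<open>N\<close>, just as the
    closed sets \<open>H n\<close> below exhaust \<open>G\<close>.\<close>
  define P where "P n = {x \<in> N. to_nat_on N x \<le> n}" for n
  have P: "finite (P n)" "P n \<subseteq> N" for n
  proof -
    have "inj_on (to_nat_on N) (P n)"
      by (rule inj_on_subset[OF inj_on_to_nat_on[OF N]]) (auto simp: P_def)
    moreover have "to_nat_on N ` P n \<subseteq> {..n}"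
      by (auto simp: P_def)
    ultimately show "finite (P n)"
      using finite_image_iff finite_subset by blast
  qed (auto simp: P_def)
  have "fsigma_in X G"
    using S_fin_K_Omega_open_fsigma[OF S X G(1)] .
  then obtain H :: "nat \<Rightarrow> 'a set" where H: "\<And>n. closedin X (H n)" "\<And>n. H n \<subseteq> H (Suc n)" "\<Union>(range H) = G"
    unfolding fsigma_in_ascending by blast
  have Hmono: "H m \<subseteq> H n" if "m \<le> n" for m n
    using H(2) that by (rule lift_Suc_mono_le)
  have tail: "\<exists>k. \<forall>n\<ge>k. F \<inter> N \<subseteq> P n \<and> F \<inter> G \<subseteq> H n" if "finite F" for F
    using that
  proof (induction F)
    case (insert x F)
    then obtain k where k: "\<And>n. n \<ge> k \<Longrightarrow> F \<inter> N \<subseteq> P n \<and> F \<inter> G \<subseteq> H n"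
      by blast
    obtain l where "x \<in> G \<longrightarrow> x \<in> H l"
      using H(3) by blast
    then show ?case
      using k Hmono by (intro exI[of _ "max k (max l (to_nat_on N x))"]) (auto simp: P_def, blast+)
  qed simp
  \<comment> \<open>\<open>P n\<close> lies in \<open>N\<close> and \<open>H n\<close> in
    \<open>G\<close>, so regularity separates the finite set from the closed one.\<close>
  have "\<exists>Q. openin X Q \<and> P n \<subseteq> Q \<and> X closure_of Q \<subseteq> topspace X - H n" for n
  proof -
    have "P n \<subseteq> topspace X - H n"
      using P(2)[of n] H(3) unfolding N_def by blast
    then show ?thesis
      using regular_space_finite_nhd[OF X(1), of "topspace X - H n" "P n"] H(1) P(1)
      by (metis openin_diff openin_topspace)
  qed
  then obtain Q where Q: "\<And>n. openin X (Q n)" "\<And>n. P n \<subseteq> Q n"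
    "\<And>n. X closure_of Q n \<subseteq> topspace X - H n"
    by metis
  define near where "near n g x \<longleftrightarrow> dist (g x) (z x) < 1 / real (Suc n)" for n g x
  \<comment> \<open>\<open>Q m\<close> brings points of \<open>N\<close> into the closure without
    asking for agreement there, and \<open>n \<le> m\<close> keeps its closure off
    \<open>H n\<close>. Agreement at points of \<open>N\<close> is instead required on
    \<open>P n\<close> directly.\<close>
  define \<V> where "\<V> n = {B \<union> Q m | B m. openin X B \<and> n \<le> m \<and>
      (\<exists>g\<in>A n. \<forall>x \<in> P n \<union> X closure_of B. near n g x)}" for n
  have cover: "closure_omega_cover X (\<V> n)" for n
    unfolding closure_omega_cover_def
  proof (intro conjI allI impI ballI)
    show "openin X U" if "U \<in> \<V> n" for U
      using that Q(1) unfolding \<V>_def by blast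
    fix F assume F: "finite F \<and> F \<subseteq> topspace X"
    obtain k where k: "\<And>m. m \<ge> k \<Longrightarrow> F \<inter> N \<subseteq> P m"
      using tail[of F] F by blast
    define m where "m = max k n"
    have m: "F \<inter> N \<subseteq> P m" "n \<le> m"
      using k by (auto simp: m_def)
    have "P n \<subseteq> topspace X"
      using P(2) unfolding N_def by blast
    then obtain g where g: "g \<in> A n" "\<And>x. x \<in> F \<union> P n \<Longrightarrow> near n g x"
      using approx[of "F \<union> P n" "1 / real (Suc n)" n] F P(1) unfolding near_def by auto
    have gq: "quasicontinuous X (top_of_set T) g"
      using g(1) A unfolding topspace_Qp by blast
    define C where "C = X interior_of {x. near n g x}"
    \<comment> \<open>Near a point of \<open>G\<close>, continuity makes \<open>z\<close> almost
      constant, and quasicontinuity supplies a nonempty open set on which \<open>g\<close> is almost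
      constant as well.\<close>
    have "F \<inter> G \<subseteq> X closure_of C"
    proof
      fix x assume x: "x \<in> F \<inter> G"
      then have xX: "x \<in> topspace X"
        using F by blast
      show "x \<in> X closure_of C"
        unfolding in_closure_of
      proof (intro conjI allI impI)
        show "x \<in> topspace X"
          by (rule xX)
        fix O' assume O': "x \<in> O' \<and> openin X O'"
        \<comment> \<open>\<open>d\<close> is half the slack in the strict inequality at
          \<open>x\<close>: one half for the variation of \<open>g\<close>, one for that of
          \<open>z\<close>.\<close>
        define d where "d = (1 / real (Suc n) - dist (g x) (z x)) / 2"
        have d: "d > 0" "2 * d + dist (g x) (z x) = 1 / real (Suc n)"
          using g(2)[of x] x unfolding d_def near_def by (simp, argo)
        obtain U where U: "openin X U" "x \<in> U" "\<And>y. y \<in> U \<Longrightarrow> dist (z y) (z x) < d"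
          using cont[of x d] x d by blast
        have "openin (top_of_set T) (T \<inter> ball (g x) d)" "g x \<in> T \<inter> ball (g x) d"
          using gq xX d by (auto simp: quasicontinuous_def openin_open_Int)
        moreover have "openin X (O' \<inter> U)" "x \<in> O' \<inter> U"
          using O' U by auto
        ultimately obtain W where W: "openin X W" "W \<noteq> {}" "W \<subseteq> O' \<inter> U" "g ` W \<subseteq> T \<inter> ball (g x) d"
          using gq xX unfolding quasicontinuous_def by meson
        have "near n g y" if "y \<in> W" for y
        proof -
          have "dist (g x) (g y) < d" "dist (z y) (z x) < d"
            using that W(3,4) U(3) by auto
          moreover have "dist (g y) (z y) \<le> dist (g x) (g y) + dist (g x) (z x) + dist (z y) (z x)"
            by metric
          ultimately show ?thesis
            unfolding near_def using d(2) by linarith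
        qed
        then have "W \<subseteq> C"
          unfolding C_def using W(1) by (intro interior_of_maximal) auto
        then show "\<exists>y. y \<in> C \<and> y \<in> O'"
          using W(2,3) by blast
      qed
    qed
    \<comment> \<open>Closeness of \<open>g\<close> to \<open>z\<close> need not pass from
      \<open>C\<close> to its closure; the Whyburn property adds only points of \<open>F\<close>,
      where it is known.\<close>
    then obtain B where B: "openin X B" "F \<inter> G \<subseteq> X closure_of B" "X closure_of B \<subseteq> C \<union> (F \<inter> G)"
      using open_Whyburn_finite[OF X(1,3), of C "F \<inter> G"] F unfolding C_def
      by (metis finite_Int openin_interior_of)
    have "near n g x" if "x \<in> P n \<union> X closure_of B" for x
      using that B(3) g(2) interior_of_subset[of X "{x. near n g x}"] unfolding C_def by blast
    then have "B \<union> Q m \<in> \<V> n"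
      unfolding \<V>_def using B(1) m(2) g(1) by blast
    moreover have "Q m \<subseteq> X closure_of Q m"
      using Q(1) by (simp add: closure_of_subset openin_subset)
    then have "F \<subseteq> X closure_of (B \<union> Q m)"
      using F B(2) m(1) Q(2)[of m] unfolding N_def closure_of_Un by blast
    ultimately show "\<exists>U\<in>\<V> n. F \<subseteq> X closure_of U"
      by blast
  qed
  obtain \<W> where \<W>: "\<And>n. finite (\<W> n)" "\<And>n. \<W> n \<subseteq> \<V> n"
    "\<And>F m. finite F \<Longrightarrow> F \<subseteq> topspace X \<Longrightarrow> \<exists>n\<ge>m. \<exists>V\<in>\<W> n. F \<subseteq> X closure_of V"
    using S_fin_K_Omega_frequently[where \<V> = \<V>, OF S cover] by metis
  have "\<forall>n. \<forall>V\<in>\<W> n. \<exists>g\<in>A n. \<forall>x \<in> P n \<union> (X closure_of V \<inter> H n). near n g x"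
  proof (intro allI ballI)
    fix n V assume "V \<in> \<W> n"
    then have "V \<in> \<V> n"
      using \<W>(2) by blast
    then obtain B m g where V: "V = B \<union> Q m" "n \<le> m" "g \<in> A n"
      "\<And>x. x \<in> P n \<union> X closure_of B \<Longrightarrow> near n g x"
      unfolding \<V>_def mem_Collect_eq by metis
    \<comment> \<open>As \<open>H n \<subseteq> H m\<close>, the closure of \<open>Q m\<close>
      contributes nothing on \<open>H n\<close>.\<close>
    have "X closure_of V \<inter> H n \<subseteq> X closure_of B"
      using Q(3)[of m] Hmono[OF V(2)] unfolding V(1) by auto
    then show "\<exists>g\<in>A n. \<forall>x \<in> P n \<union> (X closure_of V \<inter> H n). near n g x"
      using V(3,4) by blast
  qed
  then obtain g where g: "\<And>n V. V \<in> \<W> n \<Longrightarrow> g n V \<in> A n"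
    "\<And>n V x. V \<in> \<W> n \<Longrightarrow> x \<in> P n \<union> (X closure_of V \<inter> H n) \<Longrightarrow> near n (g n V) x"
    by metis
  define K where "K n = g n ` \<W> n" for n
  have K: "\<forall>n. finite (K n) \<and> K n \<subseteq> A n"
    using \<W>(1) g(1) by (auto simp: K_def)
  moreover have "z \<in> Qp X (top_of_set T) closure_of (\<Union>n. K n)"
  proof -
    have "\<exists>h\<in>\<Union>n. K n. \<forall>x\<in>F. dist (h x) (z x) < e" if F: "finite F" "F \<subseteq> topspace X" "e > 0" for F e
    proof -
      obtain k where k: "\<And>n. n \<ge> k \<Longrightarrow> F \<inter> N \<subseteq> P n \<and> F \<inter> G \<subseteq> H n"
        using tail F(1) by blast
      obtain l where l: "1 / real (Suc l) < e"
        using F(3) by (metis inverse_eq_divide reals_Archimedean)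
      \<comment> \<open>Beyond \<open>k\<close> the two parts of \<open>F\<close> lie in
        \<open>P n\<close> and \<open>H n\<close>; beyond \<open>l\<close> the tolerance is below
        \<open>e\<close>.\<close>
      obtain n V where n: "n \<ge> max k l" "V \<in> \<W> n" "F \<subseteq> X closure_of V"
        using \<W>(3) F by blast
      have "F \<subseteq> P n \<union> (X closure_of V \<inter> H n)"
        using k[of n] n F(2) unfolding N_def by auto
      then have "\<forall>x\<in>F. near n (g n V) x"
        using g(2)[OF n(2)] by blast
      moreover have "1 / real (Suc n) \<le> 1 / real (Suc l)"
        using n(1) by (simp add: frac_le)
      ultimately have "\<forall>x\<in>F. dist (g n V x) (z x) < e"
        using l unfolding near_def by force
      then show ?thesis
        using n(2) unfolding K_def by blast
    qed
    moreover have "(\<Union>n. K n) \<subseteq> topspace (Qp X (top_of_set T))"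
      using K A by blast
    ultimately show ?thesis
      using in_closure_of_Qp[of "\<Union>n. K n" X T z] z by blast
  qed
  ultimately show "\<exists>K. (\<forall>n. finite (K n) \<and> K n \<subseteq> A n) \<and> z \<in> Qp X (top_of_set T) closure_of (\<Union>n. K n)"
    by blast
qed

section \<open>Two-valued functions and the implications back to the selection principles\<close>

text \<open>Near points of \<open>A\<close>, the first inclusion of minimal boundedness supplies
  open sets inside \<open>A\<close>; near the other points, the second supplies open sets off the
  closure of \<open>A\<close>.\<close>

lemma quasicontinuous_two_valued:
  fixes a b :: 'b
  assumes A: "minimally_bounded X A" "A \<subseteq> topspace X" and Y: "a \<in> topspace Y" "b \<in> topspace Y"
  shows "quasicontinuous X Y (\<lambda>x\<in>topspace X. if x \<in> A then a else b)"
  unfolding quasicontinuous_def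
proof (intro conjI ballI allI impI)
  show "(\<lambda>x\<in>topspace X. if x \<in> A then a else b) \<in> topspace X \<rightarrow> topspace Y"
    using Y by auto
  fix x V U
  assume x: "x \<in> topspace X"
    and VU: "openin Y V \<and> (\<lambda>x\<in>topspace X. if x \<in> A then a else b) x \<in> V \<and> openin X U \<and> x \<in> U"
  show "\<exists>W. openin X W \<and> W \<noteq> {} \<and> W \<subseteq> U \<and> (\<lambda>x\<in>topspace X. if x \<in> A then a else b) ` W \<subseteq> V"
  proof (cases "x \<in> A")
    case True
    then have "x \<in> X closure_of (X interior_of A)"
      using A(1) unfolding minimally_bounded_def by blast
    then have "U \<inter> X interior_of A \<noteq> {}"
      using VU unfolding in_closure_of by blast
    moreover have "(\<lambda>x\<in>topspace X. if x \<in> A then a else b) ` (U \<inter> X interior_of A) \<subseteq> V"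
      using VU x True A(2) interior_of_subset[of X A] by auto
    ultimately show ?thesis
      using VU by (intro exI[of _ "U \<inter> X interior_of A"]) auto
  next
    case False
    then have "x \<notin> X interior_of (X closure_of A)"
      using A(1) unfolding minimally_bounded_def by blast
    then have "\<not> U \<subseteq> X closure_of A"
      using VU interior_of_maximal by blast
    then have "U - X closure_of A \<noteq> {}"
      by blast
    moreover have "A \<subseteq> X closure_of A"
      using A(2) by (rule closure_of_subset)
    then have "(\<lambda>x\<in>topspace X. if x \<in> A then a else b) ` (U - X closure_of A) \<subseteq> V"
      using VU x False openin_subset[of X U] by auto
    ultimately show ?thesis
      using VU by (intro exI[of _ "U - X closure_of A"]) (auto simp: openin_diff)
  qed
qed

text \<open>Members of a cover are coded by functions equal to \<open>0\<close> on the member and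
  \<open>1\<close> off it. Being within distance less than one of zero on \<open>F\<close> then
  means containing \<open>F\<close>, so fan tightness at zero becomes a selection of
  members.\<close>

lemma vet_omega_at_imp_S_fin_Omega_s:
  fixes T :: "real set"
  assumes T: "0 \<in> T" "1 \<in> T"
    and vet: "vet_omega_at (Qp X (top_of_set T)) (restrict (\<lambda>_. 0) (topspace X))"
  shows "S_fin (Omega_s X) (Omega_s X)"
  unfolding S_fin_def
proof (intro allI impI)
  fix \<U> :: "nat \<Rightarrow> 'a set set"
  assume \<U>: "\<forall>n. \<U> n \<in> Omega_s X"
  define ind :: "'a set \<Rightarrow> 'a \<Rightarrow> real"
    where "ind U = (\<lambda>x\<in>topspace X. if x \<in> U then 0 else 1)" for U
  let ?z = "restrict (\<lambda>_. 0) (topspace X) :: 'a \<Rightarrow> real"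
  have ind: "ind U \<in> topspace (Qp X (top_of_set T))" if "U \<in> \<U> n" for U n
  proof -
    have "minimally_bounded X U" "U \<subseteq> topspace X"
      using \<U> that unfolding Omega_s_def by auto
    then show ?thesis
      using quasicontinuous_two_valued[of X U 0 "top_of_set T" 1] T
      unfolding topspace_Qp ind_def by auto
  qed
  \<comment> \<open>Zero is the two-valued function of the whole space with both values
    equal.\<close>
  have z: "?z \<in> topspace (Qp X (top_of_set T))"
  proof -
    have "minimally_bounded X (topspace X)"
      by (simp add: minimally_bounded_def)
    from quasicontinuous_two_valued[OF this, of 0 "top_of_set T" 0]
    show ?thesis
      using T unfolding topspace_Qp by auto
  qed
  have sub: "ind ` \<U> n \<subseteq> topspace (Qp X (top_of_set T))" for n
    using ind by blast
  have "?z \<in> Qp X (top_of_set T) closure_of (ind ` \<U> n)" for n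
    unfolding in_closure_of_Qp[OF sub z]
  proof (intro allI impI)
    fix F and e :: real assume F: "finite F \<and> F \<subseteq> topspace X \<and> e > 0"
    then obtain U where "U \<in> \<U> n" "F \<subseteq> U"
      using \<U> Omega_s_D[of "\<U> n"] by metis
    then show "\<exists>g\<in>ind ` \<U> n. \<forall>x\<in>F. dist (g x) (?z x) < e"
      using F by (intro bexI[of _ "ind U"]) (auto simp: ind_def)
  qed
  then have "\<exists>K. (\<forall>n. finite (K n) \<and> K n \<subseteq> ind ` \<U> n) \<and>
      ?z \<in> Qp X (top_of_set T) closure_of (\<Union>n. K n)"
    using sub by (intro vet[unfolded vet_omega_at_def, rule_format]) simp
  then obtain K where K: "\<And>n. finite (K n)" "\<And>n. K n \<subseteq> ind ` \<U> n"
    "?z \<in> Qp X (top_of_set T) closure_of (\<Union>n. K n)"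
    by metis
  have "\<forall>n. \<exists>B. finite B \<and> B \<subseteq> \<U> n \<and> K n = ind ` B"
    using K(1,2) by (metis finite_subset_image)
  then obtain B where B: "\<And>n. finite (B n)" "\<And>n. B n \<subseteq> \<U> n" "\<And>n. K n = ind ` B n"
    by metis
  have KT: "(\<Union>n. K n) \<subseteq> topspace (Qp X (top_of_set T))"
    using K(2) sub by blast
  have cov: "\<exists>U\<in>\<Union>n. B n. F \<subseteq> U" if F: "finite F" "F \<subseteq> topspace X" for F
  proof -
    obtain g where "g \<in> (\<Union>n. K n)" "\<forall>x\<in>F. dist (g x) (?z x) < 1"
      using K(3)[unfolded in_closure_of_Qp[OF KT z], rule_format, of F 1] F by auto
    then obtain U where U: "U \<in> (\<Union>n. B n)" "\<forall>x\<in>F. dist (ind U x) (?z x) < 1"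
      unfolding B(3) by blast
    have "F \<subseteq> U"
    proof
      fix x assume "x \<in> F"
      then have "dist (ind U x) (?z x) < 1" "x \<in> topspace X"
        using U F by auto
      then show "x \<in> U"
        by (auto simp: ind_def split: if_splits)
    qed
    then show ?thesis
      using U by blast
  qed
  have mem: "U \<subseteq> topspace X \<and> minimally_bounded X U" if "U \<in> (\<Union>n. B n)" for U
    using that B(2) \<U> unfolding Omega_s_def by blast
  have "\<Union>(\<Union>n. B n) = topspace X"
  proof
    show "topspace X \<subseteq> \<Union>(\<Union>n. B n)"
    proof
      fix x assume "x \<in> topspace X"
      then show "x \<in> \<Union>(\<Union>n. B n)"
        using cov[of "{x}"] by auto
    qed
  qed (use mem in blast)
  then have "(\<Union>n. B n) \<in> Omega_s X"
    using mem cov by (simp add: Omega_s_def)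
  then show "\<exists>B. (\<forall>n. finite (B n) \<and> B n \<subseteq> \<U> n) \<and> (\<Union>n. B n) \<in> Omega_s X"
    using B(1,2) by blast
qed

text \<open>Closures of the open sets are minimally bounded and form a cover in
  \<open>Omega_s\<close>. A finite selection of closures is the image of a finite selection of open
  sets, which inherit non-density from the given families.\<close>

lemma S_fin_Omega_s_imp_K_Omega:
  assumes "S_fin (Omega_s X) (Omega_s X)"
  shows "S_fin (K_Omega X) (K_Omega X)"
  unfolding S_fin_def
proof (intro allI impI)
  fix \<U> :: "nat \<Rightarrow> 'a set set"
  assume \<U>: "\<forall>n. \<U> n \<in> K_Omega X"
  have "(closure_of) X ` \<U> n \<in> Omega_s X" for n
  proof -
    have "\<U> n \<in> K_Omega X"
      using \<U> by blast
    then show ?thesis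
      unfolding Omega_s_def K_Omega_def
      by (auto simp: minimally_bounded_closure_of_open closure_of_subset_topspace)
  qed
  then have "\<exists>C. (\<forall>n. finite (C n) \<and> C n \<subseteq> (closure_of) X ` \<U> n) \<and> (\<Union>n. C n) \<in> Omega_s X"
    by (intro assms[unfolded S_fin_def, rule_format])
  then obtain C where C: "\<And>n. finite (C n)" "\<And>n. C n \<subseteq> (closure_of) X ` \<U> n" "(\<Union>n. C n) \<in> Omega_s X"
    by metis
  have "\<forall>n. \<exists>B. finite B \<and> B \<subseteq> \<U> n \<and> C n = (closure_of) X ` B"
    using C(1,2) by (metis finite_subset_image)
  then obtain B where B: "\<And>n. finite (B n)" "\<And>n. B n \<subseteq> \<U> n" "\<And>n. C n = (closure_of) X ` B n"
    by metis
  have "(\<Union>n. B n) \<in> K_Omega X"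
    unfolding K_Omega_iff closure_omega_cover_def
  proof (intro conjI allI impI ballI)
    fix U assume "U \<in> (\<Union>n. B n)"
    then obtain n where "U \<in> \<U> n"
      using B(2) by blast
    moreover have "\<U> n \<in> K_Omega X"
      using \<U> by blast
    ultimately show "openin X U" "X closure_of U \<noteq> topspace X"
      by (simp_all add: K_Omega_iff closure_omega_cover_def)
  next
    fix F assume "finite F \<and> F \<subseteq> topspace X"
    then have "\<exists>U\<in>\<Union>n. C n. F \<subseteq> U"
      using Omega_s_D[OF C(3)] by blast
    then show "\<exists>U\<in>\<Union>n. B n. F \<subseteq> X closure_of U"
      unfolding B(3) by blast
  qed
  then show "\<exists>B. (\<forall>n. finite (B n) \<and> B n \<subseteq> \<U> n) \<and> (\<Union>n. B n) \<in> K_Omega X"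
    using B(1,2) by blast
qed

section \<open>Transfer to the two target spaces and the cycle of implications\<close>

text \<open>A finite T1 space is discrete. The rewriting makes the results for metric subspaces
  \<open>T\<close> available for the two-point target.\<close>

lemma discrete_topology_eq_top_of_set:
  "discrete_topology {0::real, 1} = top_of_set {0, 1}"
  by (subst eq_commute, rule subtopology_eq_discrete_topology_finite)
    (auto simp: Hausdorff_imp_t1_space)

lemma quasicontinuous_continuous_map:
  assumes "continuous_map X Y f"
  shows "quasicontinuous X Y f"
  unfolding quasicontinuous_def
proof (intro conjI ballI allI impI)
  show "f \<in> topspace X \<rightarrow> topspace Y"
    using assms by (simp add: continuous_map_def)
  fix x V U assume x: "x \<in> topspace X" and VU: "openin Y V \<and> f x \<in> V \<and> openin X U \<and> x \<in> U"
  have "openin X {y \<in> topspace X. f y \<in> V}"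
    using assms VU by (simp add: continuous_map_def)
  then show "\<exists>W. openin X W \<and> W \<noteq> {} \<and> W \<subseteq> U \<and> f ` W \<subseteq> V"
    using x VU by (intro exI[of _ "U \<inter> {y \<in> topspace X. f y \<in> V}"]) auto
qed

theorem theorem4p3:
  fixes X :: "'a topology"
  assumes "regular_space X" and "t1_space X"
    and "uncountable (topspace X)"
    and "open_Whyburn X"
  shows "(S_fin (Omega_s X) (Omega_s X) \<longleftrightarrow> S_fin (K_Omega X) (K_Omega X))
       \<and> (S_fin (K_Omega X) (K_Omega X) \<longleftrightarrow>
            vet_omega_at (Qp X euclideanreal) (restrict (\<lambda>_. 0) (topspace X)))
       \<and> (vet_omega_at (Qp X euclideanreal) (restrict (\<lambda>_. 0) (topspace X)) \<longleftrightarrow>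
            (\<forall>f. continuous_map X euclideanreal f \<longrightarrow>
               vet_omega_at (Qp X euclideanreal) (restrict f (topspace X))))
       \<and> ((\<forall>f. continuous_map X euclideanreal f \<longrightarrow>
               vet_omega_at (Qp X euclideanreal) (restrict f (topspace X)))
            \<longleftrightarrow> vet_omega (Qp X (discrete_topology {0::real, 1})))"
proof -
  let ?z = "restrict (\<lambda>_. 0) (topspace X) :: 'a \<Rightarrow> real"
  note X = assms(1,2,4)
  have k4: "vet_omega_at (Qp X euclideanreal) (restrict f (topspace X))"
    if S: "S_fin (K_Omega X) (K_Omega X)" and f: "continuous_map X euclideanreal f" for f
  proof -
    have fr: "continuous_map X euclideanreal (restrict f (topspace X))"
      using f by (rule continuous_map_eq) simp
    then have "restrict f (topspace X) \<in> topspace (Qp X (top_of_set UNIV))"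
      by (simp add: topspace_Qp quasicontinuous_continuous_map)
    moreover have "\<exists>U. openin X U \<and> x \<in> U \<and>
        (\<forall>y\<in>U. dist (restrict f (topspace X) y) (restrict f (topspace X) x) < e)"
      if "x \<in> topspace X" "e > 0" for x and e :: real
    proof -
      have "openin X {y \<in> topspace X. restrict f (topspace X) y \<in> ball (restrict f (topspace X) x) e}"
        by (rule openin_continuous_map_preimage[OF fr]) simp
      then show ?thesis
        using that by (intro exI[of _ "{y \<in> topspace X.
          restrict f (topspace X) y \<in> ball (restrict f (topspace X) x) e}"]) (auto simp: dist_commute)
    qed
    ultimately have "vet_omega_at (Qp X (top_of_set UNIV)) (restrict f (topspace X))"
      \<comment> \<open>A continuous function has no discontinuities, so \<open>G\<close> can be the
        whole space.\<close>
      by (intro S_fin_K_Omega_imp_vet_omega_at[OF S X, where G = "topspace X"]) auto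
    then show ?thesis
      by simp
  qed
  have k5: "vet_omega (Qp X (discrete_topology {0::real, 1}))"
    if S: "S_fin (K_Omega X) (K_Omega X)"
    unfolding vet_omega_def
  proof
    fix z :: "'a \<Rightarrow> real" assume z: "z \<in> topspace (Qp X (discrete_topology {0, 1}))"
    then have q: "quasicontinuous X (discrete_topology {0, 1}) z"
      by (simp add: topspace_Qp)
    \<comment> \<open>\<open>G\<close> is the open set on which \<open>z\<close> is locally
      constant. It is dense because \<open>{z x}\<close> is open in the discrete target, so
      quasicontinuity finds a nonempty open set with constant value \<open>z x\<close> inside every
      neighbourhood of \<open>x\<close>.\<close>
    define G where "G = \<Union>{U. openin X U \<and> (\<exists>c. \<forall>y\<in>U. z y = c)}"
    have opG: "openin X G"
      unfolding G_def by blast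
    have "topspace X \<subseteq> X closure_of G"
    proof
      fix x assume x: "x \<in> topspace X"
      have "\<exists>y. y \<in> G \<and> y \<in> U" if U: "x \<in> U" "openin X U" for U
      proof -
        have "openin (discrete_topology {0, 1}) {z x}"
          using q x by (auto simp: quasicontinuous_def)
        then obtain W where "openin X W" "W \<noteq> {}" "W \<subseteq> U" "z ` W \<subseteq> {z x}"
          using q x U unfolding quasicontinuous_def by blast
        then show ?thesis
          unfolding G_def by blast
      qed
      then show "x \<in> X closure_of G"
        using x by (auto simp: in_closure_of)
    qed
    then have dG: "X closure_of G = topspace X"
      by (simp add: closure_of_subset_topspace subset_antisym)
    have "\<exists>U. openin X U \<and> x \<in> U \<and> (\<forall>y\<in>U. dist (z y) (z x) < e)" if "x \<in> G" "e > 0" for x e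
    proof -
      obtain U c where "openin X U" "\<And>y. y \<in> U \<Longrightarrow> z y = c" "x \<in> U"
        using \<open>x \<in> G\<close> unfolding G_def by blast
      then show ?thesis
        using \<open>e > 0\<close> by auto
    qed
    then show "vet_omega_at (Qp X (discrete_topology {0, 1})) z"
      using z S_fin_K_Omega_imp_vet_omega_at[OF S X _ opG dG, of z "{0, 1}"]
      unfolding discrete_topology_eq_top_of_set by blast
  qed
  have r1: "S_fin (Omega_s X) (Omega_s X)" if "vet_omega_at (Qp X euclideanreal) ?z"
    using vet_omega_at_imp_S_fin_Omega_s[of UNIV X] that by simp
  have d1: "S_fin (Omega_s X) (Omega_s X)" if vet: "vet_omega (Qp X (discrete_topology {0::real, 1}))"
  proof -
    have "continuous_map X (discrete_topology {0::real, 1}) ?z"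
      by (rule continuous_map_eq[of _ _ "\<lambda>_. 0"]) auto
    then have "?z \<in> topspace (Qp X (discrete_topology {0::real, 1}))"
      by (auto simp: topspace_Qp quasicontinuous_continuous_map)
    then show ?thesis
      using vet vet_omega_at_imp_S_fin_Omega_s[of "{0, 1}" X]
      unfolding vet_omega_def discrete_topology_eq_top_of_set by simp
  qed
  \<comment> \<open>This instance leads from all continuous functions to fan tightness at zero, and
    \<open>r1\<close> then closes the cycle through \<open>Omega_s\<close> and
    \<open>K_Omega\<close>.\<close>
  have zero: "continuous_map X euclideanreal (\<lambda>_. 0)"
    by simp
  show ?thesis
    using S_fin_Omega_s_imp_K_Omega[of X] k4 k5 r1 d1 zero by blast
qed

end
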